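(* Let $k>t>0$ be integers. There is an integer $n_0(k,t)$ such that for all $n\ge n_0(k,t)$ and every $t$-intersecting family $\mathcal{F}\subset\binom{[n]}{k}$, $$\mathrm{co}_2(\mathcal{F})\le\binom{n-t}{k-t}\bigl(t+(n-k+1)(k-t)\bigr),$$ with equality only if $\mathcal{F}\cong\{F\in\binom{[n]}{k}:[t]\subset F\}$.
   Context: $[n]=\{1,\dots,n\}$ and $\binom{[n]}{k}$ is the family of $k$-element subsets of $[n]$. A family $\mathcal{F}$ is $t$-intersecting if $|F\cap F'|\ge t$ for all $F,F'\in\mathcal{F}$. For $\mathcal{F}\subset\binom{[n]}{k}$ and $E\subseteq[n]$, $d(E)$ is the number of members of $\mathcal{F}$ containing $E$, and $\mathrm{co}_2(\mathcal{F})=\sum_{E\in\binom{[n]}{k-1}}d(E)^2$. The symbol $\cong$ denotes equality up to a permutation of $[n]$. *)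

theory Defs
  imports "HOL-Library.Ramsey" "HOL-Combinatorics.Permutations"
begin

definition t_intersecting :: "nat \<Rightarrow> 'a set set \<Rightarrow> bool" where
  "t_intersecting t \<F> \<longleftrightarrow> (\<forall>A\<in>\<F>. \<forall>B\<in>\<F>. t \<le> card (A \<inter> B))"

definition degree :: "'a set set \<Rightarrow> 'a set \<Rightarrow> nat" where
  "degree \<F> E = card {F \<in> \<F>. E \<subseteq> F}"

text \<open>
  The codegree squared sum of a family of \<open>k\<close>-subsets of \<open>{1..n}\<close>. The uniformity \<open>k\<close> is an explicit
  parameter because it cannot be read off from an empty family; \<open>k \<ge> 1\<close> is intended.
\<close>
definition co2 :: "nat \<Rightarrow> nat \<Rightarrow> nat set set \<Rightarrow> nat" where
  "co2 n k \<F> = (\<Sum>E\<in>nsets {1..n} (k - 1). (degree \<F> E)\<^sup>2)"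

definition iso_families :: "nat \<Rightarrow> nat set set \<Rightarrow> nat set set \<Rightarrow> bool" where
  "iso_families n \<F> \<G> \<longleftrightarrow> (\<exists>\<pi>. \<pi> permutes {1..n} \<and> (\<lambda>F. \<pi> ` F) ` \<F> = \<G>)"

end

theory Submission
  imports Defs
begin

text \<open>
  Writing \<open>co2\<close> as a sum over the members \<open>F\<close> of \<open>\<F>\<close> of the degrees of the sets \<open>F - {x}\<close>,
  \<open>x \<in> F\<close>, turns the problem into one about the size of \<open>\<F>\<close> (lemma \<open>co2_eq_sum_over_members\<close>).
  Each of these degrees is at most \<open>n - k + 1\<close>.

  If all members contain a common \<open>t\<close>-set \<open>T\<close>, then deleting an element of \<open>T\<close> from \<open>F\<close> leaves a set
  of degree 1, so that each member contributes at most \<open>t + (n - k + 1) * (k - t)\<close>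
  (\<open>co2_le_of_common_subset\<close>). There are at
  most \<open>(n - t) choose (k - t)\<close> members, and equality forces \<open>\<F>\<close> to be the full star of \<open>T\<close>; a
  permutation then carries \<open>T\<close> to \<open>{1..t}\<close>.

  If there is no such \<open>T\<close>, fix a member \<open>F0\<close>. Each member contains some \<open>t\<close>-subset \<open>T\<close> of \<open>F0\<close>,
  and, being \<open>t\<close>-intersecting with a member that does not contain \<open>T\<close>, also one of the at most \<open>k\<close>
  elements of that member outside \<open>T\<close>. Hence \<open>\<F>\<close> is covered by boundedly many stars of
  \<open>(t+1)\<close>-sets (\<open>card_le_of_no_common_subset\<close>). Such a star is smaller than the star of a \<open>t\<close>-set by a factor
  \<open>(n - t) / (k - t)\<close>, so for large \<open>n\<close> even the crude bound \<open>k * (n - k + 1)\<close> on the contribution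
  of a member leaves \<open>co2\<close> strictly below the claimed maximum.
\<close>

section \<open>Stars and degrees\<close>

lemma card_nsets_superset:
  assumes "finite V" "S \<subseteq> V" "card S \<le> k"
  shows "card {F \<in> nsets V k. S \<subseteq> F} = (card V - card S) choose (k - card S)"
proof -
  have fS: "finite S"
    using assms finite_subset by blast
  have "bij_betw (\<lambda>G. G \<union> S) (nsets (V - S) (k - card S)) {F \<in> nsets V k. S \<subseteq> F}"
  proof (rule bij_betw_byWitness[where f' = "\<lambda>F. F - S"])
    show "(\<lambda>G. G \<union> S) ` nsets (V - S) (k - card S) \<subseteq> {F \<in> nsets V k. S \<subseteq> F}"
    proof (intro image_subsetI)
      fix G assume "G \<in> nsets (V - S) (k - card S)"
      then have G: "G \<subseteq> V - S" "finite G" "card G = k - card S"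
        by (auto simp: nsets_def)
      then have "card (G \<union> S) = card G + card S"
        using fS by (intro card_Un_disjoint) auto
      with G fS assms show "G \<union> S \<in> {F \<in> nsets V k. S \<subseteq> F}"
        by (auto simp: nsets_def)
    qed
    show "(\<lambda>F. F - S) ` {F \<in> nsets V k. S \<subseteq> F} \<subseteq> nsets (V - S) (k - card S)"
      using fS by (auto simp: nsets_def card_Diff_subset)
  qed (auto simp: nsets_def)
  then have "card {F \<in> nsets V k. S \<subseteq> F} = card (nsets (V - S) (k - card S))"
    by (rule bij_betw_same_card[symmetric])
  also have "\<dots> = (card V - card S) choose (k - card S)"
    using assms fS by (simp add: card_nsets card_Diff_subset)
  finally show ?thesis .
qed

lemma degree_le:
  assumes "finite V" "\<F> \<subseteq> nsets V k" "E \<in> nsets V (k - 1)" "0 < k"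
  shows "degree \<F> E \<le> card V - k + 1"
proof -
  have E: "E \<subseteq> V" "card E = k - 1"
    using assms by (auto simp: nsets_def)
  have "degree \<F> E \<le> card {F \<in> nsets V k. E \<subseteq> F}"
    unfolding degree_def using assms by (intro card_mono) (auto simp: finite_imp_finite_nsets)
  also have "\<dots> = card V - (k - 1)"
    using assms E by (simp add: card_nsets_superset)
  also have "\<dots> \<le> card V - k + 1"
    by simp
  finally show ?thesis .
qed

text \<open>
  Expanding one factor of each square counts the pairs \<open>E \<subset> F\<close> with weight the degree of \<open>E\<close>, and the \<open>(k-1)\<close>-subsets of \<open>F\<close>
  are the sets \<open>F - {x}\<close>.
\<close>

lemma co2_eq_sum_over_members:
  assumes "\<F> \<subseteq> nsets {1..n} k" "0 < k"
  shows "co2 n k \<F> = (\<Sum>F\<in>\<F>. \<Sum>x\<in>F. degree \<F> (F - {x}))"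
proof -
  let ?N = "nsets {1..n} (k - 1)"
  have fin: "finite \<F>" "finite ?N"
    using finite_subset[OF assms(1)] by (simp_all add: finite_imp_finite_nsets)
  have inner: "(\<Sum>E\<in>{E \<in> ?N. E \<subseteq> F}. degree \<F> E) = (\<Sum>x\<in>F. degree \<F> (F - {x}))"
    if "F \<in> \<F>" for F
  proof (rule sum.reindex_bij_betw[symmetric])
    have F: "F \<subseteq> {1..n}" "finite F" "card F = k"
      using that assms by (auto simp: nsets_def)
    have "inj_on (\<lambda>x. F - {x}) F"
      by (rule inj_onI) blast
    moreover have "(\<lambda>x. F - {x}) ` F = {E \<in> ?N. E \<subseteq> F}"
    proof
      show "(\<lambda>x. F - {x}) ` F \<subseteq> {E \<in> ?N. E \<subseteq> F}"
        using F by (auto simp: nsets_def)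
      show "{E \<in> ?N. E \<subseteq> F} \<subseteq> (\<lambda>x. F - {x}) ` F"
      proof
        fix E assume "E \<in> {E \<in> ?N. E \<subseteq> F}"
        then have E: "E \<subseteq> F" "card E = k - 1" "finite E"
          by (auto simp: nsets_def)
        then have "card (F - E) = 1"
          using F assms(2) by (simp add: card_Diff_subset)
        then obtain x where "F - E = {x}"
          by (auto simp: card_1_singleton_iff)
        with E have "x \<in> F" "E = F - {x}"
          by auto
        then show "E \<in> (\<lambda>x. F - {x}) ` F"
          by blast
      qed
    qed
    ultimately show "bij_betw (\<lambda>x. F - {x}) F {E \<in> ?N. E \<subseteq> F}"
      by (simp add: bij_betw_def)
  qed
  have "co2 n k \<F> = (\<Sum>E\<in>?N. \<Sum>F\<in>{F \<in> \<F>. E \<subseteq> F}. degree \<F> E)"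
    by (simp add: co2_def power2_eq_square) (simp add: degree_def)
  also have "\<dots> = (\<Sum>F\<in>\<F>. \<Sum>E\<in>{E \<in> ?N. E \<subseteq> F}. degree \<F> E)"
    by (rule sum.swap_restrict[OF fin(2,1)])
  also have "\<dots> = (\<Sum>F\<in>\<F>. \<Sum>x\<in>F. degree \<F> (F - {x}))"
    using inner by (rule sum.cong[OF refl])
  finally show ?thesis .
qed

lemma degree_remove_le:
  assumes "\<F> \<subseteq> nsets {1..n} k" "0 < k" "F \<in> \<F>" "x \<in> F"
  shows "degree \<F> (F - {x}) \<le> n - k + 1"
proof -
  have "F - {x} \<in> nsets {1..n} (k - 1)"
    using assms by (auto simp: nsets_def)
  then show ?thesis
    using degree_le[of "{1..n}" \<F> k "F - {x}"] assms by simp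
qed

lemma co2_le_card_mult:
  assumes "\<F> \<subseteq> nsets {1..n} k" "0 < k"
  shows "co2 n k \<F> \<le> card \<F> * (k * (n - k + 1))"
proof -
  have "(\<Sum>x\<in>F. degree \<F> (F - {x})) \<le> k * (n - k + 1)" if "F \<in> \<F>" for F
  proof -
    have "card F = k"
      using that assms by (auto simp: nsets_def)
    then show ?thesis
      using sum_bounded_above[of F "\<lambda>x. degree \<F> (F - {x})" "n - k + 1"]
        degree_remove_le[OF assms that] by simp
  qed
  then show ?thesis
    using sum_bounded_above[of \<F> "\<lambda>F. \<Sum>x\<in>F. degree \<F> (F - {x})" "k * (n - k + 1)"]
    by (simp add: co2_eq_sum_over_members[OF assms])
qed

section \<open>Families contained in the star of a \<open>t\<close>-set\<close>

text \<open>
  If \<open>x \<in> T\<close>, then a member containing \<open>F - {x}\<close> also contains \<open>x\<close>, hence equals \<open>F\<close>. So the \<open>t\<close>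
  elements of \<open>T\<close> contribute 1 each, the remaining \<open>k - t\<close> elements at most \<open>n - k + 1\<close> each.
\<close>

lemma co2_le_of_common_subset:
  assumes \<F>: "\<F> \<subseteq> nsets {1..n} k" and "0 < k" and T: "finite T" "card T = t" "\<forall>F\<in>\<F>. T \<subseteq> F"
  shows "co2 n k \<F> \<le> card \<F> * (t + (n - k + 1) * (k - t))"
proof -
  have "(\<Sum>x\<in>F. degree \<F> (F - {x})) \<le> t + (n - k + 1) * (k - t)" if F: "F \<in> \<F>" for F
  proof -
    have cF: "finite F" "card F = k" "T \<subseteq> F"
      using F \<F> T by (auto simp: nsets_def)
    have one: "degree \<F> (F - {x}) \<le> 1" if "x \<in> T" for x
    proof -
      have "G = F" if "G \<in> \<F>" "F - {x} \<subseteq> G" for G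
      proof -
        have "F \<subseteq> G"
          using that \<open>x \<in> T\<close> T by blast
        moreover have "finite G" "card G = k"
          using that \<F> by (auto simp: nsets_def)
        ultimately show ?thesis
          using cF card_subset_eq by metis
      qed
      then have "{G \<in> \<F>. F - {x} \<subseteq> G} \<subseteq> {F}"
        by blast
      then show ?thesis
        unfolding degree_def using card_mono[of "{F}"] by fastforce
    qed
    have "(\<Sum>x\<in>F. degree \<F> (F - {x})) =
        (\<Sum>x\<in>F - T. degree \<F> (F - {x})) + (\<Sum>x\<in>T. degree \<F> (F - {x}))"
      using cF by (intro sum.subset_diff)
    also have "\<dots> \<le> (k - t) * (n - k + 1) + t * 1"
    proof (rule add_mono)
      have "card (F - T) = k - t"
        using cF T by (simp add: card_Diff_subset)
      then show "(\<Sum>x\<in>F - T. degree \<F> (F - {x})) \<le> (k - t) * (n - k + 1)"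
        using sum_bounded_above[of "F - T" "\<lambda>x. degree \<F> (F - {x})" "n - k + 1"]
          degree_remove_le[OF \<F> \<open>0 < k\<close> F] by simp
      show "(\<Sum>x\<in>T. degree \<F> (F - {x})) \<le> t * 1"
        using sum_bounded_above[of T "\<lambda>x. degree \<F> (F - {x})" 1] one T by simp
    qed
    finally show ?thesis
      by (simp add: mult.commute add.commute)
  qed
  then show ?thesis
    using sum_bounded_above[of \<F> "\<lambda>F. \<Sum>x\<in>F. degree \<F> (F - {x})" "t + (n - k + 1) * (k - t)"]
    by (simp add: co2_eq_sum_over_members[OF \<F> \<open>0 < k\<close>])
qed

lemma exists_permutation_onto_initial_segment:
  assumes "T \<subseteq> {1..n}" "card T = t"
  shows "\<exists>\<pi>. \<pi> permutes {1..n} \<and> \<pi> ` T = {1..t}"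
proof -
  have fT: "finite T"
    using assms finite_subset by blast
  have tn: "t \<le> n"
    using card_mono[OF _ assms(1)] assms(2) by simp
  obtain f where f: "bij_betw f T {1..t}"
    using finite_same_card_bij[OF fT, of "{1..t}"] assms by auto
  have "card ({1..n} - T) = card {t+1..n}"
    using assms fT by (simp add: card_Diff_subset)
  then obtain g where g: "bij_betw g ({1..n} - T) {t+1..n}"
    using finite_same_card_bij[of "{1..n} - T" "{t+1..n}"] by auto
  define \<pi> where "\<pi> x = (if x \<in> T then f x else if x \<in> {1..n} then g x else x)" for x
  have onT: "bij_betw \<pi> T {1..t}"
    using f by (rule bij_betw_cong[THEN iffD1, rotated]) (simp add: \<pi>_def)
  moreover have "bij_betw \<pi> ({1..n} - T) {t+1..n}"
    using g by (rule bij_betw_cong[THEN iffD1, rotated]) (simp add: \<pi>_def)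
  ultimately have "bij_betw \<pi> (T \<union> ({1..n} - T)) ({1..t} \<union> {t+1..n})"
    by (rule bij_betw_combine) auto
  moreover have "T \<union> ({1..n} - T) = {1..n}" "{1..t} \<union> {t+1..n} = {1..n}"
    using assms tn by auto
  ultimately have "\<pi> permutes {1..n}"
    using assms by (intro bij_imp_permutes) (auto simp: \<pi>_def)
  with onT show ?thesis
    by (auto simp: bij_betw_def)
qed

lemma iso_families_star:
  assumes "T \<subseteq> {1..n}" "card T = t"
  shows "iso_families n {F \<in> nsets {1..n} k. T \<subseteq> F} {F \<in> nsets {1..n} k. {1..t} \<subseteq> F}"
proof -
  obtain \<pi> where \<pi>: "\<pi> permutes {1..n}" "\<pi> ` T = {1..t}"
    using exists_permutation_onto_initial_segment[OF assms] by blast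
  have map: "\<sigma> ` F \<in> nsets {1..n} k" if "\<sigma> permutes {1..n}" "F \<in> nsets {1..n} k" for \<sigma> F
  proof -
    have "card (\<sigma> ` F) = card F"
      using that permutes_inj_on card_image by metis
    moreover have "\<sigma> ` F \<subseteq> \<sigma> ` {1..n}"
      using that by (intro image_mono) (auto simp: nsets_def)
    ultimately show ?thesis
      using that permutes_image[of \<sigma> "{1..n}"] by (simp add: nsets_def)
  qed
  have "(\<lambda>F. \<pi> ` F) ` {F \<in> nsets {1..n} k. T \<subseteq> F} = {F \<in> nsets {1..n} k. {1..t} \<subseteq> F}"
  proof
    show "(\<lambda>F. \<pi> ` F) ` {F \<in> nsets {1..n} k. T \<subseteq> F} \<subseteq> {F \<in> nsets {1..n} k. {1..t} \<subseteq> F}"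
      using map[OF \<pi>(1)] \<pi>(2) by blast
    show "{F \<in> nsets {1..n} k. {1..t} \<subseteq> F} \<subseteq> (\<lambda>F. \<pi> ` F) ` {F \<in> nsets {1..n} k. T \<subseteq> F}"
    proof
      fix G assume "G \<in> {F \<in> nsets {1..n} k. {1..t} \<subseteq> F}"
      then have G: "G \<in> nsets {1..n} k" "\<pi> ` T \<subseteq> G"
        using \<pi> by auto
      have "inv \<pi> ` G \<in> nsets {1..n} k"
        using map[OF permutes_inv[OF \<pi>(1)]] G by blast
      moreover have "T \<subseteq> inv \<pi> ` G"
        using G(2) image_mono[of "\<pi> ` T" G "inv \<pi>"] permutes_inv_o(2)[OF \<pi>(1)]
        by (simp add: image_comp)
      moreover have "\<pi> ` inv \<pi> ` G = G"
        using permutes_inv_o(1)[OF \<pi>(1)] by (simp add: image_comp)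
      ultimately show "G \<in> (\<lambda>F. \<pi> ` F) ` {F \<in> nsets {1..n} k. T \<subseteq> F}"
        by (metis (mono_tags, lifting) image_eqI mem_Collect_eq)
    qed
  qed
  with \<pi>(1) show ?thesis
    unfolding iso_families_def by blast
qed

section \<open>Families without a common \<open>t\<close>-set\<close>

text \<open>
  For each \<open>t\<close>-subset \<open>T\<close> of a fixed member \<open>F0\<close>, let \<open>w T\<close> be a member not containing \<open>T\<close>.
  A member \<open>F\<close> meets \<open>F0\<close> in a set containing some such \<open>T\<close>; as \<open>w T \<inter> T\<close> has fewer than \<open>t\<close>
  elements, \<open>F\<close> must meet \<open>w T\<close> outside \<open>T\<close> as well.
\<close>

lemma card_le_of_no_common_subset:
  assumes \<F>: "\<F> \<subseteq> nsets {1..n} k" and int: "t_intersecting t \<F>" and "t < k"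
    and F0: "F0 \<in> \<F>" and no: "\<And>T. T \<subseteq> F0 \<Longrightarrow> card T = t \<Longrightarrow> \<exists>F\<in>\<F>. \<not> T \<subseteq> F"
  shows "card \<F> \<le> (k choose t) * k * ((n - t - 1) choose (k - t - 1))"
proof -
  let ?star = "\<lambda>S. {F \<in> nsets {1..n} k. S \<subseteq> F}"
  have mem: "F \<subseteq> {1..n}" "finite F" "card F = k" if "F \<in> \<F>" for F
    using that \<F> by (auto simp: nsets_def)
  have nT: "T \<subseteq> F0" "card T = t" "finite T" if "T \<in> nsets F0 t" for T
    using that by (auto simp: nsets_def)
  have "\<forall>T\<in>nsets F0 t. \<exists>F. F \<in> \<F> \<and> \<not> T \<subseteq> F"
    using no[OF nT(1,2)] by blast
  then obtain w where w: "\<And>T. T \<in> nsets F0 t \<Longrightarrow> w T \<in> \<F> \<and> \<not> T \<subseteq> w T"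
    by metis
  have cover: "\<F> \<subseteq> (\<Union>T\<in>nsets F0 t. \<Union>x\<in>w T - T. ?star (insert x T))"
  proof
    fix F assume F: "F \<in> \<F>"
    have "t \<le> card (F0 \<inter> F)"
      using int F F0 by (auto simp: t_intersecting_def)
    then obtain T where T: "T \<subseteq> F0 \<inter> F" "card T = t" "finite T"
      by (rule obtain_subset_with_card_n)
    then have TN: "T \<in> nsets F0 t"
      by (auto simp: nsets_def)
    have "\<not> F \<inter> w T \<subseteq> T"
    proof
      assume "F \<inter> w T \<subseteq> T"
      then have "F \<inter> w T \<subset> T"
        using w[OF TN] by blast
      then have "card (F \<inter> w T) < t"
        using T psubset_card_mono by blast
      then show False
        using int F w[OF TN] by (fastforce simp: t_intersecting_def)
    qed
    then obtain x where "x \<in> w T - T" "x \<in> F"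
      by blast
    then show "F \<in> (\<Union>T\<in>nsets F0 t. \<Union>x\<in>w T - T. ?star (insert x T))"
      using TN T F \<F> by blast
  qed
  let ?N = "(n - t - 1) choose (k - t - 1)"
  have finN: "finite (nsets F0 t)" and cardN: "card (nsets F0 t) = k choose t"
    using mem[OF F0] by (simp_all add: finite_imp_finite_nsets card_nsets)
  have star: "card (?star (insert x T)) = ?N" if "T \<in> nsets F0 t" "x \<in> w T - T" for T x
  proof -
    have "insert x T \<subseteq> {1..n}" "card (insert x T) = t + 1"
      using that nT[OF that(1)] mem[OF F0] w[OF that(1)] mem[of "w T"] by auto
    then show ?thesis
      using card_nsets_superset[of "{1..n}" "insert x T" k] \<open>t < k\<close> by simp
  qed
  have inner: "card (\<Union>x\<in>w T - T. ?star (insert x T)) \<le> k * ?N" if T: "T \<in> nsets F0 t" for T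
  proof -
    have fw: "finite (w T)" "card (w T) = k"
      using w[OF T] mem by auto
    have "card (\<Union>x\<in>w T - T. ?star (insert x T)) \<le> (\<Sum>x\<in>w T - T. card (?star (insert x T)))"
      using fw by (intro card_UN_le) simp
    also have "\<dots> = card (w T - T) * ?N"
      using star[OF T] by simp
    also have "\<dots> \<le> k * ?N"
      using fw card_mono[of "w T" "w T - T"] by (intro mult_right_mono) auto
    finally show ?thesis .
  qed
  have "finite (\<Union>T\<in>nsets F0 t. \<Union>x\<in>w T - T. ?star (insert x T))"
    by (rule finite_subset[of _ "nsets {1..n} k"]) (auto simp: finite_imp_finite_nsets)
  then have "card \<F> \<le> card (\<Union>T\<in>nsets F0 t. \<Union>x\<in>w T - T. ?star (insert x T))"
    using cover by (rule card_mono)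
  also have "\<dots> \<le> (\<Sum>T\<in>nsets F0 t. card (\<Union>x\<in>w T - T. ?star (insert x T)))"
    using finN by (rule card_UN_le)
  also have "\<dots> \<le> (k choose t) * (k * ?N)"
    unfolding cardN[symmetric] using sum_bounded_above[OF inner, of "nsets F0 t"] by simp
  finally show ?thesis
    by (simp add: mult.assoc)
qed

section \<open>The extremal theorem\<close>

theorem proposition4p2:
  fixes k t :: nat
  assumes "0 < t" and "t < k"
  shows "\<exists>n0::nat. \<forall>n\<ge>n0. \<forall>\<F>. \<F> \<subseteq> nsets {1..n} k \<and> t_intersecting t \<F> \<longrightarrow>
    co2 n k \<F> \<le> ((n - t) choose (k - t)) * (t + (n - k + 1) * (k - t)) \<and>
    (co2 n k \<F> = ((n - t) choose (k - t)) * (t + (n - k + 1) * (k - t)) \<longrightarrow>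
      iso_families n \<F> {F \<in> nsets {1..n} k. {1..t} \<subseteq> F})"
proof -
  \<comment> \<open>For \<open>n \<ge> n0\<close>, this gives \<open>(k choose t) * k * k < n - t\<close>, which makes the bound for
    families without a common \<open>t\<close>-set strictly smaller.\<close>
  define n0 where "n0 = k + (k choose t) * k * k + 1"
  have "co2 n k \<F> \<le> ((n - t) choose (k - t)) * (t + (n - k + 1) * (k - t)) \<and>
    (co2 n k \<F> = ((n - t) choose (k - t)) * (t + (n - k + 1) * (k - t)) \<longrightarrow>
      iso_families n \<F> {F \<in> nsets {1..n} k. {1..t} \<subseteq> F})"
    if n: "n \<ge> n0" and \<F>: "\<F> \<subseteq> nsets {1..n} k" and int: "t_intersecting t \<F>" for n \<F>
  proof (cases "\<exists>T. T \<subseteq> {1..n} \<and> card T = t \<and> (\<forall>F\<in>\<F>. T \<subseteq> F)")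
    case True
    then obtain T where T: "T \<subseteq> {1..n}" "card T = t" "\<forall>F\<in>\<F>. T \<subseteq> F"
      by blast
    let ?S = "{F \<in> nsets {1..n} k. T \<subseteq> F}" and ?c = "t + (n - k + 1) * (k - t)"
    have sub: "\<F> \<subseteq> ?S"
      using \<F> T by blast
    have finS: "finite ?S"
      by (simp add: finite_imp_finite_nsets)
    have cardS: "card ?S = (n - t) choose (k - t)"
      using card_nsets_superset[of "{1..n}" T k] T assms by simp
    have le: "co2 n k \<F> \<le> card \<F> * ?c"
      using co2_le_of_common_subset[OF \<F> _ finite_subset[OF T(1)] T(2,3)] assms by simp
    moreover have "card \<F> * ?c \<le> card ?S * ?c"
      using sub finS by (intro mult_right_mono card_mono) auto
    moreover have "iso_families n \<F> {F \<in> nsets {1..n} k. {1..t} \<subseteq> F}"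
      if "co2 n k \<F> = card ?S * ?c"
    proof -
      have "card ?S \<le> card \<F>"
        using le that \<open>0 < t\<close> by simp
      then have "\<F> = ?S"
        using sub finS by (simp add: card_seteq)
      then show ?thesis
        using iso_families_star[OF T(1,2)] by simp
    qed
    ultimately show ?thesis
      unfolding cardS by linarith
  next
    case False
    have "t \<le> card {1..n}"
      using n assms by (simp add: n0_def)
    then obtain T0 where "T0 \<subseteq> {1..n}" "card T0 = t"
      by (rule obtain_subset_with_card_n)
    with False obtain F0 where F0: "F0 \<in> \<F>"
      by blast
    then have "F0 \<subseteq> {1..n}"
      using \<F> by (auto simp: nsets_def)
    then have no: "\<exists>F\<in>\<F>. \<not> T \<subseteq> F" if "T \<subseteq> F0" "card T = t" for T
      using False that by blast
    let ?N = "(n - t - 1) choose (k - t - 1)"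
    have absorb: "(k - t) * ((n - t) choose (k - t)) = (n - t) * ?N"
      using times_binomial_minus1_eq[of "k - t" "n - t"] assms by simp
    have "co2 n k \<F> \<le> card \<F> * (k * (n - k + 1))"
      using co2_le_card_mult[OF \<F>] assms by simp
    also have "\<dots> \<le> ((k choose t) * k * ?N) * (k * (n - k + 1))"
      using card_le_of_no_common_subset[OF \<F> int \<open>t < k\<close> F0 no] by (rule mult_right_mono) auto
    also have "\<dots> = ((k choose t) * k * k) * (?N * (n - k + 1))"
      by (simp add: algebra_simps)
    also have "\<dots> < (n - t) * (?N * (n - k + 1))"
    proof (rule mult_strict_right_mono)
      show "(k choose t) * k * k < n - t"
        using n assms by (simp add: n0_def)
      show "0 < ?N * (n - k + 1)"
        using n assms by (simp add: n0_def)
    qed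
    also have "\<dots> = ((n - t) * ?N) * (n - k + 1)"
      by (simp only: mult.assoc)
    also have "\<dots> = ((n - t) choose (k - t)) * ((n - k + 1) * (k - t))"
      unfolding absorb[symmetric] by (simp only: mult_ac)
    also have "\<dots> \<le> ((n - t) choose (k - t)) * (t + (n - k + 1) * (k - t))"
      by (intro mult_left_mono) auto
    finally show ?thesis
      by simp
  qed
  then show ?thesis
    by blast
qed

end
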